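(* Let $A=[a_{ij}]\in\mathbb{C}^{n\times n}$ and assume that $$|a_{11}-a_{ii}|>\sum_{j\neq 1}|a_{1j}|+\sum_{j\neq i}|a_{ij}|\qquad\text{for all } i=2,\dots,n .$$ Regard $A-a_{11}I$ as a linear map of $\mathbb{C}\times\mathbb{C}^{n-1}$ into itself. Then $A-a_{11}I$ is dominating, i.e. $\rangle A-a_{11}I\langle\;<\;\langle A-a_{11}I\rangle$. Moreover, $$\rangle A-a_{11}I\langle\;\le\;\sum_{j\neq 1}|a_{1j}|\;<\;\langle A-a_{11}I\rangle ,$$ and if $\sum_{j\neq 1}|a_{1j}|>0$, then $$\rangle A-a_{11}I\langle\;<\;\sum_{j\neq 1}|a_{1j}| .$$
   Context: Write $x\in\mathbb{C}^n$ as $x=(x_1,\mathsf{x}_2)\in\mathbb{C}\times\mathbb{C}^{n-1}$, where $\mathbb{C}^{n-1}$ carries the maximum norm $\|\cdot\|_\infty$, and put $\|x\|_\infty=\max(|x_1|,\|\mathsf{x}_2\|_\infty)$. For a linear map $B:\mathbb{C}\times\mathbb{C}^{n-1}\to\mathbb{C}\times\mathbb{C}^{n-1}$, with $(Bx)_1\in\mathbb{C}$ and $(Bx)_{2}\in\mathbb{C}^{n-1}$ denoting the two components of $Bx$, define $$\rangle B\langle\;:=\inf\{R\in[0,\infty) : \|Bx\|_\infty\le R\|x\|_\infty\ \text{for all } x \text{ with } |(Bx)_1|\ge\|(Bx)_2\|_\infty\},$$ $$\langle B\rangle:=\sup\{R\in[0,\infty) : \|Bx\|_\infty\ge R\|x\|_\infty\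 \text{for all } x \text{ with } |x_1|\le\|\mathsf{x}_2\|_\infty\}$$ (the supremum is $+\infty$ if unbounded). $B$ is called dominating if $\rangle B\langle\;<\langle B\rangle$. *)

theory Defs
  imports
    "Jordan_Normal_Form.Matrix"
    "HOL-Library.Extended_Real"
begin

text \<open>
  Vectors in \<open>\<complex>\<^sup>n\<close> are elements of \<open>carrier_vec n\<close>, indexed from 0: the distinguished first
  coordinate is \<open>x $ 0\<close>, and \<open>tail_part x\<close> collects the remaining \<open>n - 1\<close> coordinates.
  For \<open>n = 1\<close> the tail is the empty vector.
\<close>

definition head_part :: "complex vec \<Rightarrow> complex" where
  "head_part x = x $ 0"

definition tail_part :: "complex vec \<Rightarrow> complex vec" where
  "tail_part x = vec_last x (dim_vec x - 1)"

text \<open>The element 0 is inserted so that the empty vector has norm 0.\<close>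

definition max_norm :: "complex vec \<Rightarrow> real" where
  "max_norm v = Max (insert 0 ((\<lambda>i. cmod (v $ i)) ` {..<dim_vec v}))"

definition block_norm :: "complex vec \<Rightarrow> real" where
  "block_norm x = max (cmod (head_part x)) (max_norm (tail_part x))"

definition linear_vec_map :: "nat \<Rightarrow> (complex vec \<Rightarrow> complex vec) \<Rightarrow> bool" where
  "linear_vec_map n B \<longleftrightarrow>
     (\<forall>x\<in>carrier_vec n. B x \<in> carrier_vec n) \<and>
     (\<forall>x\<in>carrier_vec n. \<forall>y\<in>carrier_vec n. B (x + y) = B x + B y) \<and>
     (\<forall>c. \<forall>x\<in>carrier_vec n. B (c \<cdot>\<^sub>v x) = c \<cdot>\<^sub>v B x)"

text \<open>
  The two rates \<open>\<rangle>B\<langle>\<close> and \<open>\<langle>B\<rangle>\<close> are taken in the extended reals, so that the supremum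
  is \<open>\<infinity>\<close> if the set is unbounded.
\<close>

definition upper_rate :: "nat \<Rightarrow> (complex vec \<Rightarrow> complex vec) \<Rightarrow> ereal" where
  "upper_rate n B =
     Inf {ereal R | R. 0 \<le> R \<and>
       (\<forall>x\<in>carrier_vec n. cmod (head_part (B x)) \<ge> max_norm (tail_part (B x)) \<longrightarrow>
          block_norm (B x) \<le> R * block_norm x)}"

definition lower_rate :: "nat \<Rightarrow> (complex vec \<Rightarrow> complex vec) \<Rightarrow> ereal" where
  "lower_rate n B =
     Sup {ereal R | R. 0 \<le> R \<and>
       (\<forall>x\<in>carrier_vec n. cmod (head_part x) \<le> max_norm (tail_part x) \<longrightarrow>
          block_norm (B x) \<ge> R * block_norm x)}"

definition dominating :: "nat \<Rightarrow> (complex vec \<Rightarrow> complex vec) \<Rightarrow> bool" where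
  "dominating n B \<longleftrightarrow> linear_vec_map n B \<and> upper_rate n B < lower_rate n B"

definition off_diag_row_sum :: "complex mat \<Rightarrow> nat \<Rightarrow> real" where
  "off_diag_row_sum A i = (\<Sum>j\<in>{..<dim_col A} - {i}. cmod (A $$ (i, j)))"

definition shifted_map :: "nat \<Rightarrow> complex mat \<Rightarrow> complex vec \<Rightarrow> complex vec" where
  "shifted_map n A x = (A - (A $$ (0, 0)) \<cdot>\<^sub>m 1\<^sub>m n) *\<^sub>v x"

end

theory Submission
  imports Defs
begin

text \<open>
  Put \<open>B = A - a\<^sub>1\<^sub>1 I\<close>, \<open>y = B x\<close>, and let \<open>t = |x\<^sub>k|\<close> be the maximum norm of the tail of \<open>x\<close>.
  The first row of \<open>B\<close> has a zero on the diagonal, so \<open>|y\<^sub>1| \<le> s t\<close> with \<open>s = \<Sum>\<^sub>j\<^sub>\<noteq>\<^sub>1 |a\<^sub>1\<^sub>j|\<close>,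
  whereas row \<open>k\<close> gives \<open>|y\<^sub>k| \<ge> (s + \<delta>) t + |a\<^sub>k\<^sub>1| (t - |x\<^sub>1|)\<close>, where \<open>\<delta> > 0\<close> is a uniform gap
  in the hypothesis. If \<open>|x\<^sub>1| \<le> t\<close>, then \<open>\<parallel>y\<parallel> \<ge> (s + \<delta>) \<parallel>x\<parallel>\<close>. If \<open>|y\<^sub>k| \<le> |y\<^sub>1|\<close>, the two estimates
  force \<open>(\<delta> + |a\<^sub>k\<^sub>1|) t \<le> |a\<^sub>k\<^sub>1| |x\<^sub>1|\<close>, hence \<open>t \<le> c |x\<^sub>1|\<close> with a uniform \<open>c < 1\<close>, and \<open>|y\<^sub>1| \<le> c s \<parallel>x\<parallel>\<close>.
\<close>

lemma tail_part_simps: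
  "dim_vec (tail_part x) = dim_vec x - 1"
  "i < dim_vec x - 1 \<Longrightarrow> tail_part x $ i = x $ Suc i"
  by (auto simp: tail_part_def vec_last_def)

lemma max_norm_tail_part_nonneg: "0 \<le> max_norm (tail_part x)"
  by (simp add: max_norm_def)

lemma cmod_index_le_max_norm_tail_part:
  assumes "x \<in> carrier_vec n" "i \<in> {1..<n}"
  shows "cmod (x $ i) \<le> max_norm (tail_part x)"
proof -
  have "cmod (x $ i) = cmod (tail_part x $ (i - 1))" "i - 1 < dim_vec (tail_part x)"
    using assms by (auto simp: tail_part_simps)
  then show ?thesis
    unfolding max_norm_def by (intro Max_ge) auto
qed

text \<open>The inserted 0 in \<open>max_norm\<close> makes a separate case necessary: for n = 1 the
  tail is empty and no index attains the norm.\<close>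

lemma max_norm_tail_part_cases:
  assumes "x \<in> carrier_vec n"
  obtains (zero) "max_norm (tail_part x) = 0"
  | (attained) k where "k \<in> {1..<n}" "cmod (x $ k) = max_norm (tail_part x)"
proof -
  let ?v = "tail_part x"
  have "max_norm ?v \<in> insert 0 ((\<lambda>i. cmod (?v $ i)) ` {..<dim_vec ?v})"
    unfolding max_norm_def by (rule Max_in) auto
  then consider "max_norm ?v = 0" | i where "i < n - 1" "max_norm ?v = cmod (x $ Suc i)"
    using assms by (auto simp: tail_part_simps)
  then show thesis
  proof cases
    case 1
    then show ?thesis by (rule zero)
  next
    case (2 i)
    then show ?thesis by (intro attained[of "Suc i"]) auto
  qed
qed

lemma linear_vec_map_mult_mat_vec:
  assumes "M \<in> carrier_mat n n"
  shows "linear_vec_map n ((*\<^sub>v) M)"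
  using assms
  by (auto simp: linear_vec_map_def mult_add_distrib_mat_vec[OF assms] mult_mat_vec)

text \<open>The shift alters only the diagonal coefficient, which becomes 0 in row 0; the rest of
  row i has exactly the entries counted by \<open>off_diag_row_sum A i\<close>.\<close>

lemma shifted_map_index:
  assumes "A \<in> carrier_mat n n" "x \<in> carrier_vec n" "i < n"
  shows "shifted_map n A x $ i =
    (A $$ (i, i) - A $$ (0, 0)) * x $ i + (\<Sum>j\<in>{..<n} - {i}. A $$ (i, j) * x $ j)"
proof -
  have "shifted_map n A x $ i =
      (\<Sum>j<n. (A $$ (i, j) - A $$ (0, 0) * (if i = j then 1 else 0)) * x $ j)"
    using assms by (simp add: shifted_map_def scalar_prod_def lessThan_atLeast0)
  also have "\<dots> = (A $$ (i, i) - A $$ (0, 0)) * x $ i + (\<Sum>j\<in>{..<n} - {i}. A $$ (i, j) * x $ j)"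
    using assms(3) by (subst sum.remove[of _ i]) (auto intro!: sum.cong)
  finally show ?thesis .
qed

lemma shifted_map_head_le:
  assumes "A \<in> carrier_mat n n" "x \<in> carrier_vec n" "n \<ge> 1"
  shows "cmod (head_part (shifted_map n A x)) \<le> off_diag_row_sum A 0 * max_norm (tail_part x)"
proof -
  have "cmod (head_part (shifted_map n A x)) = cmod (\<Sum>j\<in>{..<n} - {0}. A $$ (0, j) * x $ j)"
    using assms by (simp add: head_part_def shifted_map_index)
  also have "\<dots> \<le> (\<Sum>j\<in>{..<n} - {0}. cmod (A $$ (0, j)) * max_norm (tail_part x))"
    by (intro sum_norm_le)
      (auto simp: norm_mult intro!: mult_left_mono cmod_index_le_max_norm_tail_part[OF assms(2)])
  also have "\<dots> = off_diag_row_sum A 0 * max_norm (tail_part x)"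
    using assms by (simp add: off_diag_row_sum_def sum_distrib_right)
  finally show ?thesis .
qed

text \<open>Reverse triangle inequality in row k. The term with \<open>A $$ (k, 0)\<close> is kept
  apart because \<open>head_part x\<close> is not controlled by the tail norm; the second summand
  corrects for \<open>off_diag_row_sum A k\<close> having charged that entry with the tail
  norm.\<close>

lemma shifted_map_tail_ge:
  assumes A: "A \<in> carrier_mat n n" and x: "x \<in> carrier_vec n" and k: "k \<in> {1..<n}"
    and max: "cmod (x $ k) = max_norm (tail_part x)"
  shows "(cmod (A $$ (0, 0) - A $$ (k, k)) - off_diag_row_sum A k) * max_norm (tail_part x)
      + cmod (A $$ (k, 0)) * (max_norm (tail_part x) - cmod (head_part x))
    \<le> max_norm (tail_part (shifted_map n A x))"
proof -
  let ?t = "max_norm (tail_part x)" and ?y = "shifted_map n A x"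
  let ?S = "\<Sum>j\<in>{..<n} - {k}. A $$ (k, j) * x $ j"
  let ?J = "{..<n} - {k} - {0}"
  have y: "?y \<in> carrier_vec n"
    using A by (auto simp: shifted_map_def carrier_vecI)
  have zero: "0 \<in> {..<n} - {k}"
    using k by auto
  have "cmod ?S \<le> (\<Sum>j\<in>{..<n} - {k}. cmod (A $$ (k, j)) * cmod (x $ j))"
    by (intro sum_norm_le) (simp add: norm_mult)
  also have "\<dots> = cmod (A $$ (k, 0)) * cmod (x $ 0) + (\<Sum>j\<in>?J. cmod (A $$ (k, j)) * cmod (x $ j))"
    using zero by (intro sum.remove) auto
  also have "\<dots> \<le> cmod (A $$ (k, 0)) * cmod (x $ 0) + (\<Sum>j\<in>?J. cmod (A $$ (k, j)) * ?t)"
    by (intro add_left_mono sum_mono mult_left_mono cmod_index_le_max_norm_tail_part[OF x]) auto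
  also have "(\<Sum>j\<in>?J. cmod (A $$ (k, j)) * ?t) = (off_diag_row_sum A k - cmod (A $$ (k, 0))) * ?t"
    using A zero by (simp add: off_diag_row_sum_def sum_distrib_right[symmetric] sum.remove[of "{..<n} - {k}" 0])
  finally have S: "cmod ?S \<le> cmod (A $$ (k, 0)) * cmod (head_part x)
      + (off_diag_row_sum A k - cmod (A $$ (k, 0))) * ?t"
    by (simp add: head_part_def)
  have "cmod (A $$ (0, 0) - A $$ (k, k)) * ?t - cmod ?S
      = cmod ((A $$ (k, k) - A $$ (0, 0)) * x $ k) - cmod ?S"
    by (simp add: norm_mult max norm_minus_commute)
  also have "\<dots> \<le> cmod (?y $ k)"
    using k norm_diff_ineq by (simp add: shifted_map_index[OF A x])
  also have "\<dots> \<le> max_norm (tail_part ?y)"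
    by (rule cmod_index_le_max_norm_tail_part[OF y k])
  finally show ?thesis
    using S by (simp add: algebra_simps)
qed

lemma finite_uniform_gap:
  fixes f g :: "'a \<Rightarrow> real"
  assumes "finite I" "\<And>i. i \<in> I \<Longrightarrow> f i < g i"
  obtains \<delta> where "\<delta> > 0" "\<And>i. i \<in> I \<Longrightarrow> f i + \<delta> \<le> g i"
proof
  \<comment> \<open>The 1 keeps the minimum defined and positive when \<open>I\<close> is
    empty.\<close>
  let ?\<delta> = "Min (insert 1 ((\<lambda>i. g i - f i) ` I))"
  show "?\<delta> > 0"
    using assms by auto
  show "f i + ?\<delta> \<le> g i" if "i \<in> I" for i
  proof -
    have "?\<delta> \<le> g i - f i"
      using assms(1) that by (intro Min_le) auto
    then show ?thesis by simp
  qed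
qed

text \<open>Where the head of \<open>B x\<close> dominates, \<open>block_norm (B x)\<close> is the
  modulus of that head, so bounding the head suffices.\<close>

lemma upper_rate_le:
  assumes "0 \<le> R"
    and "\<And>x. x \<in> carrier_vec n \<Longrightarrow> max_norm (tail_part (B x)) \<le> cmod (head_part (B x))
      \<Longrightarrow> cmod (head_part (B x)) \<le> R * block_norm x"
  shows "upper_rate n B \<le> ereal R"
  unfolding upper_rate_def using assms by (intro Inf_lower) (auto simp: block_norm_def)

text \<open>Where the tail of \<open>x\<close> dominates, \<open>block_norm x\<close> is the tail
  norm, while \<open>block_norm (B x)\<close> is at least the tail norm of
  \<open>B x\<close>.\<close>

lemma lower_rate_ge:
  assumes "0 \<le> R"
    and "\<And>x. x \<in> carrier_vec n \<Longrightarrow> cmod (head_part x) \<le> max_norm (tail_part x)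
      \<Longrightarrow> R * max_norm (tail_part x) \<le> max_norm (tail_part (B x))"
  shows "ereal R \<le> lower_rate n B"
  unfolding lower_rate_def using assms
  by (intro Sup_upper) (auto simp: block_norm_def max_absorb2 intro: max.coboundedI2)

theorem theorem5p2:
  fixes n :: nat and A :: "complex mat"
  assumes "n \<ge> 1"
    and "A \<in> carrier_mat n n"
    and "\<forall>i\<in>{1..<n}. cmod (A $$ (0, 0) - A $$ (i, i))
           > off_diag_row_sum A 0 + off_diag_row_sum A i"
  shows "dominating n (shifted_map n A)
    \<and> upper_rate n (shifted_map n A) \<le> ereal (off_diag_row_sum A 0)
    \<and> ereal (off_diag_row_sum A 0) < lower_rate n (shifted_map n A)
    \<and> (off_diag_row_sum A 0 > 0 \<longrightarrow>
         upper_rate n (shifted_map n A) < ereal (off_diag_row_sum A 0))"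
proof -
  let ?B = "shifted_map n A"
  let ?t = "\<lambda>x. max_norm (tail_part x)"
  define s where "s = off_diag_row_sum A 0"
  have s: "s \<ge> 0"
    by (simp add: s_def off_diag_row_sum_def sum_nonneg)
  obtain \<delta> where \<delta>: "\<delta> > 0"
    and gap: "\<And>k. k \<in> {1..<n} \<Longrightarrow>
      off_diag_row_sum A 0 + off_diag_row_sum A k + \<delta> \<le> cmod (A $$ (0, 0) - A $$ (k, k))"
    using finite_uniform_gap[of "{1..<n}" "\<lambda>k. off_diag_row_sum A 0 + off_diag_row_sum A k"
        "\<lambda>k. cmod (A $$ (0, 0) - A $$ (k, k))"] assms(3) by auto
  obtain c where c: "0 \<le> c" "c < 1"
    and ratio: "\<And>k. k \<in> {1..<n} \<Longrightarrow> cmod (A $$ (k, 0)) / (\<delta> + cmod (A $$ (k, 0))) \<le> c"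
  proof
    let ?q = "\<lambda>k. cmod (A $$ (k, 0)) / (\<delta> + cmod (A $$ (k, 0)))"
    \<comment> \<open>Each ratio is below 1 because \<delta> > 0, and a finite maximum preserves
      this; the 0 covers n = 1, where there are no ratios.\<close>
    let ?c = "Max (insert 0 (?q ` {1..<n}))"
    show "0 \<le> ?c"
      by simp
    have "\<delta> + cmod (A $$ (k, 0)) > 0" for k
      using \<delta> by (simp add: add_pos_nonneg)
    then show "?c < 1"
      using \<delta> by (simp add: divide_less_eq)
    show "?q k \<le> ?c" if "k \<in> {1..<n}" for k
      using that by (intro Max_ge) auto
  qed
  have tail: "(s + \<delta>) * ?t x + cmod (A $$ (k, 0)) * (?t x - cmod (head_part x)) \<le> ?t (?B x)"
    if "x \<in> carrier_vec n" "k \<in> {1..<n}" "cmod (x $ k) = ?t x" for x k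
  proof -
    have "(s + \<delta>) * ?t x \<le> (cmod (A $$ (0, 0) - A $$ (k, k)) - off_diag_row_sum A k) * ?t x"
      using gap[OF that(2)] by (intro mult_right_mono max_norm_tail_part_nonneg) (simp add: s_def)
    then show ?thesis
      using shifted_map_tail_ge[OF assms(2) that] by linarith
  qed
  have "ereal (s + \<delta>) \<le> lower_rate n ?B"
  proof (rule lower_rate_ge)
    fix x
    assume x: "x \<in> carrier_vec n" "cmod (head_part x) \<le> ?t x"
    from x(1) show "(s + \<delta>) * ?t x \<le> ?t (?B x)"
    proof (cases rule: max_norm_tail_part_cases)
      case zero
      then show ?thesis by (simp add: max_norm_tail_part_nonneg)
    next
      case (attained k)
      have "0 \<le> cmod (A $$ (k, 0)) * (?t x - cmod (head_part x))"
        using x(2) by simp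
      then show ?thesis
        using tail[OF x(1) attained] by linarith
    qed
  qed (use s \<delta> in simp)
  moreover have "ereal s < ereal (s + \<delta>)"
    using \<delta> by simp
  ultimately have lower: "ereal s < lower_rate n ?B"
    by (rule less_le_trans[rotated])
  \<comment> \<open>The factor c serves both claims: s * c never exceeds s, and it is strictly
    smaller once s > 0.\<close>
  have upper: "upper_rate n ?B \<le> ereal (s * c)"
  proof (rule upper_rate_le)
    fix x
    assume x: "x \<in> carrier_vec n" and y: "?t (?B x) \<le> cmod (head_part (?B x))"
    have head: "cmod (head_part (?B x)) \<le> s * ?t x"
      unfolding s_def using assms(1,2) x by (intro shifted_map_head_le)
    have "?t x \<le> c * cmod (head_part x)"
      using x
    proof (cases rule: max_norm_tail_part_cases)
      case zero
      then show ?thesis using c by simp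
    next
      case (attained k)
      let ?a = "cmod (A $$ (k, 0))"
      \<comment> \<open>Chaining \<open>tail\<close>, \<open>y\<close> and \<open>head\<close> puts
        s times the tail norm on both sides, where it cancels.\<close>
      have "(\<delta> + ?a) * ?t x \<le> ?a * cmod (head_part x)"
        using tail[OF x attained] head y by (simp add: algebra_simps)
      moreover have "\<delta> + ?a > 0"
        using \<delta> by (simp add: add_pos_nonneg)
      ultimately have "?t x \<le> ?a / (\<delta> + ?a) * cmod (head_part x)"
        by (simp add: field_simps)
      also have "\<dots> \<le> c * cmod (head_part x)"
        by (intro mult_right_mono ratio attained) simp
      finally show ?thesis .
    qed
    also have "\<dots> \<le> c * block_norm x"
      using c by (intro mult_left_mono) (simp_all add: block_norm_def)
    finally have "s * ?t x \<le> s * (c * block_norm x)"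
      using s by (rule mult_left_mono)
    then show "cmod (head_part (?B x)) \<le> s * c * block_norm x"
      using head by (simp add: mult.assoc)
  qed (use s c in simp)
  have "s * c \<le> s"
    using s c by (simp add: mult_left_le)
  then have upper_le: "upper_rate n ?B \<le> ereal s"
    using upper by (metis ereal_less_eq(3) order_trans)
  have upper_less: "upper_rate n ?B < ereal s" if "s > 0"
    using that c upper by (metis less_ereal.simps(1) le_less_trans mult.right_neutral mult_less_cancel_left_pos)
  have "linear_vec_map n ?B"
    unfolding shifted_map_def[abs_def] using assms(2)
    by (intro linear_vec_map_mult_mat_vec) auto
  then have "dominating n ?B"
    unfolding dominating_def using upper_le lower by (blast intro: le_less_trans)
  then show ?thesis
    using upper_le upper_less lower by (simp add: s_def)
qed

end
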